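(* Let $R$ be a finite commutative chain ring with maximal ideal $\mathfrak{m}=\langle\theta\rangle$ and nilpotency index $\nu$, let $E$ be a finite set, let $C\le R^E$ be an $R$-code, and let $e\in E$. Suppose $C$ is contractible by $e$, and write $\mathrm{pr}_e(C)=\langle\theta^t\rangle$ with $0\le t<\nu$. Then $C$ has a generator matrix, with the column indexed by $e$ listed first, of the form $$G_0=\begin{pmatrix} u\theta^t & \mathbf{a}^\top\\ 0 & G_0'\end{pmatrix}$$ with $u\in R^\times$ and every entry of $\mathbf{a}$ in $\langle\theta^t\rangle$; and for any such $G_0$, $$M(C_{\{e\}})=M[G_0']=M(C)/\{e\}.$$
   Context: For a local ring $R$ with maximal ideal $\mathfrak{m}$: elements $v_1,\dots,v_\ell$ of an $R$-module are modular independent if $\sum\alpha_iv_i=0$ implies every $\alpha_i\in\mathfrak{m}$. For a matrix $G$ over $R$ with columns indexed by a finite set $E'$, $M[G]$ is the independence system on $E'$ whose independent sets are the $I\subseteq E'$ with $(G\text{'s columns indexed by }I)$ modular independent. An $R$-code is an $R$-submodule $C\le R^E$; a generator matrix of $C$ is a matrix whose rows form a minimal generating set of $C$; $M(C):=M[G]$ for any generator matrix $G$ (this is independent of the choice). $\mathrm{pr}_e\colon C\to R$ is the $e$-th coordinate map. The shortened code is $C_X=\{\mathbf{c}|_{E\setminus X}:\mathbf{c}\in C,\ c_i=0\ \forall i\in X\}\le R^{E\setminus X}$. $C$ is contractible by $e$ if $\mathrm{pr}_e(C)\neq\{0\}$, say $\mathrm{pr}_e(C)=\langle\theta^t\rangle$,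 and there is $\mathbf{c}\in C$ with $c_e=u\theta^t$ for some unit $u$ and $c_i\in\langle\theta^t\rangle$ for all $i\in E$. Circuits of an independence system are its minimal dependent sets. For an independence system with circuit family $\mathcal{C}$ on $E$ and an independent set $T\subseteq E$, the contraction $M/T$ is the independence system on $E\setminus T$ whose circuit family is the set of inclusion-minimal members of $\{D\setminus T: D\in\mathcal{C}\}$. *)

theory Defs
  imports Complex_Main "HOL-Library.Function_Algebras"
begin

section \<open>Chain rings\<close>

text \<open>Ideals of a commutative ring are the submodules of the regular module.\<close>

abbreviation is_ideal :: "'r::comm_ring_1 set \<Rightarrow> bool" where
  "is_ideal \<equiv> module.subspace (*)"

abbreviation principal_ideal :: "'r::comm_ring_1 \<Rightarrow> 'r set" (\<open>\<langle>_\<rangle>\<close>) where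
  "\<langle>a\<rangle> \<equiv> module.span (*) {a}"

definition maximal_ideal :: "'r::comm_ring_1 set \<Rightarrow> bool" where
  "maximal_ideal I \<longleftrightarrow> is_ideal I \<and> I \<noteq> UNIV \<and>
     (\<forall>J. is_ideal J \<longrightarrow> I \<subseteq> J \<longrightarrow> J = I \<or> J = UNIV)"

text \<open>Only meaningful for a local ring, where the maximal ideal is unique.\<close>

definition max_ideal :: "'r::comm_ring_1 set" where
  "max_ideal = (THE I. maximal_ideal I)"

definition chain_ring :: "'r::comm_ring_1 itself \<Rightarrow> bool" where
  "chain_ring _ \<longleftrightarrow> (\<forall>I J :: 'r set. is_ideal I \<longrightarrow> is_ideal J \<longrightarrow> I \<subseteq> J \<or> J \<subseteq> I)"

definition nilpotency_index :: "'r::comm_ring_1 \<Rightarrow> nat" where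
  "nilpotency_index a = (LEAST n. a ^ n = 0)"

section \<open>Independence systems\<close>

record 'e indep_system =
  ground :: "'e set"
  indep :: "'e set set"

definition independence_system :: "'e indep_system \<Rightarrow> bool" where
  "independence_system M \<longleftrightarrow> finite (ground M) \<and> indep M \<subseteq> Pow (ground M) \<and>
     {} \<in> indep M \<and> (\<forall>I\<in>indep M. \<forall>J\<subseteq>I. J \<in> indep M)"

definition minimal_members :: "'e set set \<Rightarrow> 'e set set" where
  "minimal_members F = {D \<in> F. \<forall>D'\<in>F. D' \<subseteq> D \<longrightarrow> D' = D}"

definition circuits :: "'e indep_system \<Rightarrow> 'e set set" where
  "circuits M = minimal_members {D. D \<subseteq> ground M \<and> D \<notin> indep M}"

definition system_of_circuits :: "'e set \<Rightarrow> 'e set set \<Rightarrow> 'e indep_system" where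
  "system_of_circuits E F = \<lparr>ground = E, indep = {I. I \<subseteq> E \<and> (\<forall>D\<in>F. \<not> D \<subseteq> I)}\<rparr>"

text \<open>The contraction is intended for independent \<open>T\<close>; see \<open>independence_system_contraction\<close> and
  \<open>circuits_contraction\<close> below.\<close>

definition contraction :: "'e indep_system \<Rightarrow> 'e set \<Rightarrow> 'e indep_system" where
  "contraction M T =
     system_of_circuits (ground M - T) (minimal_members {D - T |D. D \<in> circuits M})"

section \<open>Codes\<close>

text \<open>Vectors in \<open>R\<^sup>E\<close> are represented by functions on the whole index type that vanish
  outside \<open>E\<close>, so that addition is the pointwise addition of functions.\<close>

definition vecs :: "'e set \<Rightarrow> ('e \<Rightarrow> 'r::comm_ring_1) set" where
  "vecs E = {c. \<forall>i. i \<notin> E \<longrightarrow> c i = 0}"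

definition vscale :: "'r::comm_ring_1 \<Rightarrow> ('e \<Rightarrow> 'r) \<Rightarrow> 'e \<Rightarrow> 'r" where
  "vscale a c = (\<lambda>i. a * c i)"

definition vrestrict :: "'e set \<Rightarrow> ('e \<Rightarrow> 'r::comm_ring_1) \<Rightarrow> 'e \<Rightarrow> 'r" where
  "vrestrict E c = (\<lambda>i. if i \<in> E then c i else 0)"

definition is_code :: "'e set \<Rightarrow> ('e \<Rightarrow> 'r::comm_ring_1) set \<Rightarrow> bool" where
  "is_code E C \<longleftrightarrow> C \<subseteq> vecs E \<and> module.subspace vscale C"

definition pr :: "'e \<Rightarrow> ('e \<Rightarrow> 'r::comm_ring_1) \<Rightarrow> 'r" where
  "pr e c = c e"

definition shortened :: "'e set \<Rightarrow> ('e \<Rightarrow> 'r::comm_ring_1) set \<Rightarrow> 'e set \<Rightarrow> ('e \<Rightarrow> 'r) set" where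
  "shortened E C X = vrestrict (E - X) ` {c \<in> C. \<forall>i\<in>X. c i = 0}"

definition contractible ::
  "'r::comm_ring_1 \<Rightarrow> 'e set \<Rightarrow> ('e \<Rightarrow> 'r) set \<Rightarrow> 'e \<Rightarrow> bool" where
  "contractible \<theta> E C e \<longleftrightarrow> pr e ` C \<noteq> {0} \<and>
     (\<exists>t. pr e ` C = \<langle>\<theta> ^ t\<rangle> \<and>
          (\<exists>c\<in>C. (\<exists>u. u dvd 1 \<and> c e = u * \<theta> ^ t) \<and> (\<forall>i\<in>E. c i \<in> \<langle>\<theta> ^ t\<rangle>)))"

section \<open>Matrices and their independence systems\<close>

text \<open>A matrix with columns indexed by \<open>E\<close> is the list of its rows, each a vector in \<open>R\<^sup>E\<close>.
  A column is a vector indexed by the row numbers \<open>{..<length G}\<close>.\<close>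

type_synonym ('e, 'r) rowmat = "('e \<Rightarrow> 'r) list"

definition column :: "('e, 'r::comm_ring_1) rowmat \<Rightarrow> 'e \<Rightarrow> nat \<Rightarrow> 'r" where
  "column G j = (\<lambda>i. if i < length G then (G ! i) j else 0)"

definition modular_independent ::
  "('r::comm_ring_1 \<Rightarrow> 'v::ab_group_add \<Rightarrow> 'v) \<Rightarrow> 'j set \<Rightarrow> ('j \<Rightarrow> 'v) \<Rightarrow> bool" where
  "modular_independent scale J v \<longleftrightarrow>
     (\<forall>\<alpha>. (\<Sum>j\<in>J. scale (\<alpha> j) (v j)) = 0 \<longrightarrow> (\<forall>j\<in>J. \<alpha> j \<in> max_ideal))"

definition matrix_system :: "'e set \<Rightarrow> ('e, 'r::comm_ring_1) rowmat \<Rightarrow> 'e indep_system" where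
  "matrix_system E G =
     \<lparr>ground = E, indep = {I. I \<subseteq> E \<and> modular_independent vscale I (column G)}\<rparr>"

definition minimal_generating_set ::
  "('e \<Rightarrow> 'r::comm_ring_1) set \<Rightarrow> ('e \<Rightarrow> 'r) set \<Rightarrow> bool" where
  "minimal_generating_set C S \<longleftrightarrow>
     module.span vscale S = C \<and> (\<forall>S'. S' \<subset> S \<longrightarrow> module.span vscale S' \<noteq> C)"

definition generator_matrix ::
  "('e \<Rightarrow> 'r::comm_ring_1) set \<Rightarrow> ('e, 'r) rowmat \<Rightarrow> bool" where
  "generator_matrix C G \<longleftrightarrow> distinct G \<and> minimal_generating_set C (set G)"

text \<open>The choice of generator matrix is immaterial; see \<open>code_system_eq\<close> below.\<close>

definition code_system :: "'e set \<Rightarrow> ('e \<Rightarrow> 'r::comm_ring_1) set \<Rightarrow> 'e indep_system" where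
  "code_system E C = matrix_system E (SOME G. generator_matrix C G)"

text \<open>The block matrix with first row \<open>(p, a)\<close> and remaining rows \<open>(0, g)\<close> for the rows \<open>g\<close>
  of \<open>G'\<close>, where the first column has index \<open>e\<close> and \<open>a\<close>, \<open>G'\<close> have columns in \<open>E - {e}\<close>.\<close>

definition block_matrix ::
  "'e \<Rightarrow> 'r::comm_ring_1 \<Rightarrow> ('e \<Rightarrow> 'r) \<Rightarrow> ('e, 'r) rowmat \<Rightarrow> ('e, 'r) rowmat" where
  "block_matrix e p a G' = a(e := p) # map (\<lambda>g. g(e := 0)) G'"

definition pivot_form ::
  "'r::comm_ring_1 \<Rightarrow> nat \<Rightarrow> 'e set \<Rightarrow> 'e \<Rightarrow> ('e, 'r) rowmat \<Rightarrow> ('e, 'r) rowmat \<Rightarrow> bool" where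
  "pivot_form \<theta> t E e G G' \<longleftrightarrow> set G' \<subseteq> vecs (E - {e}) \<and>
     (\<exists>u a. u dvd 1 \<and> a \<in> vecs (E - {e}) \<and> (\<forall>i\<in>E - {e}. a i \<in> \<langle>\<theta> ^ t\<rangle>) \<and>
            G = block_matrix e (u * \<theta> ^ t) a G')"

section \<open>Well-definedness\<close>

lemma module_mult: "module ((*) :: 'r::comm_ring_1 \<Rightarrow> 'r \<Rightarrow> 'r)"
  by unfold_locales (simp_all add: algebra_simps)

lemma module_vscale: "module (vscale :: 'r::comm_ring_1 \<Rightarrow> ('e \<Rightarrow> 'r) \<Rightarrow> 'e \<Rightarrow> 'r)"
  by unfold_locales (simp_all add: vscale_def fun_eq_iff algebra_simps)

lemma max_ideal_eq:
  assumes "chain_ring TYPE('r::comm_ring_1)" "maximal_ideal (I :: 'r set)"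
  shows "max_ideal = I"
  unfolding max_ideal_def
proof (rule the_equality)
  show "maximal_ideal I" by (fact assms(2))
next
  fix J :: "'r set"
  assume "maximal_ideal J"
  with assms show "J = I"
    unfolding chain_ring_def maximal_ideal_def by metis
qed

lemma minimal_member_below:
  assumes "finite D" "D \<in> F"
  shows "\<exists>D'\<in>minimal_members F. D' \<subseteq> D"
  using assms
proof (induction D rule: finite_psubset_induct)
  case (psubset D)
  show ?case
  proof (cases "D \<in> minimal_members F")
    case False
    then obtain D' where "D' \<in> F" "D' \<subset> D"
      using psubset.prems by (auto simp: minimal_members_def)
    from psubset.IH[OF this(2,1)] obtain D'' where "D'' \<in> minimal_members F" "D'' \<subseteq> D'"
      by blast
    with \<open>D' \<subset> D\<close> show ?thesis by (intro bexI[of _ D'']) auto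
  next
    case True
    then show ?thesis by (intro bexI[of _ D]) auto
  qed
qed

lemma circuits_system_of_circuits:
  assumes "F \<subseteq> Pow E" "minimal_members F = F"
  shows "circuits (system_of_circuits E F) = F"
proof -
  have m: "D' = D" if "D \<in> F" "D' \<in> F" "D' \<subseteq> D" for D D'
    using that assms(2) unfolding minimal_members_def by blast
  have "{D. D \<subseteq> E \<and> D \<notin> {I. I \<subseteq> E \<and> (\<forall>D\<in>F. \<not> D \<subseteq> I)}} = {D. D \<subseteq> E \<and> (\<exists>D'\<in>F. D' \<subseteq> D)}"
    by blast
  moreover have "minimal_members {D. D \<subseteq> E \<and> (\<exists>D'\<in>F. D' \<subseteq> D)} = F"
  proof (intro equalityI subsetI)
    fix D assume "D \<in> minimal_members {D. D \<subseteq> E \<and> (\<exists>D'\<in>F. D' \<subseteq> D)}"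
    then show "D \<in> F" unfolding minimal_members_def by blast
  next
    fix D assume D: "D \<in> F"
    then have "D \<subseteq> E" using assms(1) by blast
    moreover have "D' = D" if "D' \<subseteq> D" "D'' \<in> F" "D'' \<subseteq> D'" for D' D''
      using m[OF D \<open>D'' \<in> F\<close>] that by blast
    ultimately show "D \<in> minimal_members {D. D \<subseteq> E \<and> (\<exists>D'\<in>F. D' \<subseteq> D)}"
      using D unfolding minimal_members_def by blast
  qed
  ultimately show ?thesis
    by (simp add: circuits_def system_of_circuits_def)
qed

lemma system_of_circuits_circuits:
  assumes "independence_system (M :: 'e indep_system)"
  shows "system_of_circuits (ground M) (circuits M) = M"
proof -
  have fin: "finite (ground M)" and sub: "\<And>I. I \<in> indep M \<Longrightarrow> I \<subseteq> ground M"
    and down: "\<And>I J. I \<in> indep M \<Longrightarrow> J \<subseteq> I \<Longrightarrow> J \<in> indep M"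
    using assms by (auto simp: independence_system_def)
  have "I \<subseteq> ground M \<and> (\<forall>D\<in>circuits M. \<not> D \<subseteq> I) \<longleftrightarrow> I \<in> indep M" for I
  proof
    assume I: "I \<subseteq> ground M \<and> (\<forall>D\<in>circuits M. \<not> D \<subseteq> I)"
    show "I \<in> indep M"
    proof (rule ccontr)
      assume "I \<notin> indep M"
      with I have "I \<in> {D. D \<subseteq> ground M \<and> D \<notin> indep M}" by simp
      moreover have "finite I" using I fin finite_subset by metis
      ultimately show False
        using I minimal_member_below[of I "{D. D \<subseteq> ground M \<and> D \<notin> indep M}"]
        by (simp add: circuits_def)
    qed
  next
    assume I: "I \<in> indep M"
    have "D \<notin> indep M" if "D \<in> circuits M" for D
      using that by (simp add: circuits_def minimal_members_def)
    with I sub[OF I] down[OF I] show "I \<subseteq> ground M \<and> (\<forall>D\<in>circuits M. \<not> D \<subseteq> I)"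
      by metis
  qed
  then show ?thesis by (simp add: system_of_circuits_def)
qed

lemma minimal_members_subset: "minimal_members F \<subseteq> F"
  by (simp add: minimal_members_def)

lemma minimal_members_idem: "minimal_members (minimal_members F) = minimal_members F"
  by (auto simp: minimal_members_def)

lemma independence_system_contraction:
  assumes "independence_system M" "T \<in> indep M"
  shows "independence_system (contraction M T)"
proof -
  have "\<not> D \<subseteq> T" if "D \<in> circuits M" for D
  proof
    assume "D \<subseteq> T"
    then have "D \<in> indep M" using assms unfolding independence_system_def by simp
    with that show False by (simp add: circuits_def minimal_members_def)
  qed
  then have "{} \<notin> {D - T |D. D \<in> circuits M}"
    by auto
  then have "{} \<notin> minimal_members {D - T |D. D \<in> circuits M}"
    using minimal_members_subset by blast
  moreover have "finite (ground M - T)"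
    using assms(1) by (simp add: independence_system_def)
  moreover have "independence_system (system_of_circuits E F)" if "finite E" "{} \<notin> F"
    for E :: "'a set" and F
    using that unfolding independence_system_def system_of_circuits_def
    by (auto dest: subset_trans)
  ultimately show ?thesis
    unfolding contraction_def by blast
qed

lemma circuits_contraction:
  "circuits (contraction M T) = minimal_members {D - T |D. D \<in> circuits M}"
proof -
  have "{D - T |D. D \<in> circuits M} \<subseteq> Pow (ground M - T)"
    by (auto simp: circuits_def minimal_members_def)
  then have "minimal_members {D - T |D. D \<in> circuits M} \<subseteq> Pow (ground M - T)"
    using minimal_members_subset by (rule subset_trans[rotated])
  then show ?thesis
    unfolding contraction_def
    by (rule circuits_system_of_circuits) (rule minimal_members_idem)
qed

lemma column_relation_iff:
  "(\<Sum>j\<in>J. vscale (\<alpha> j) (column G j)) = 0 \<longleftrightarrow> (\<forall>g\<in>set G. (\<Sum>j\<in>J. \<alpha> j * g j) = 0)"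
proof -
  have "(\<Sum>j\<in>J. vscale (\<alpha> j) (column G j)) i =
      (if i < length G then \<Sum>j\<in>J. \<alpha> j * (G ! i) j else 0)" for i
    by (induction J rule: infinite_finite_induct) (auto simp: vscale_def column_def)
  then have "(\<Sum>j\<in>J. vscale (\<alpha> j) (column G j)) = 0 \<longleftrightarrow>
      (\<forall>i<length G. (\<Sum>j\<in>J. \<alpha> j * (G ! i) j) = 0)"
    by (simp add: fun_eq_iff)
  then show ?thesis
    by (simp add: all_set_conv_all_nth)
qed

lemma orthogonal_span:
  assumes "\<forall>g\<in>S. (\<Sum>j\<in>J. \<alpha> j * g j) = 0" "c \<in> module.span vscale S"
  shows "(\<Sum>j\<in>J. \<alpha> j * c j) = (0 :: 'r::comm_ring_1)"
proof -
  interpret module "vscale :: 'r \<Rightarrow> ('a \<Rightarrow> 'r) \<Rightarrow> 'a \<Rightarrow> 'r"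
    by (rule module_vscale)
  have "(\<Sum>j\<in>J. \<alpha> j * (r * x j)) = r * (\<Sum>j\<in>J. \<alpha> j * x j)" for r x
    by (simp add: sum_distrib_left mult.left_commute)
  then have "subspace {c. (\<Sum>j\<in>J. \<alpha> j * c j) = 0}"
    by (auto simp: subspace_def vscale_def distrib_left sum.distrib)
  moreover have "S \<subseteq> {c. (\<Sum>j\<in>J. \<alpha> j * c j) = 0}"
    using assms(1) by blast
  ultimately show ?thesis
    using assms(2) span_minimal by blast
qed

lemma matrix_system_cong:
  assumes "module.span vscale (set G) = module.span vscale (set H)"
  shows "matrix_system E G = matrix_system E H"
proof -
  interpret module "vscale :: 'b \<Rightarrow> ('a \<Rightarrow> 'b) \<Rightarrow> 'a \<Rightarrow> 'b"
    by (rule module_vscale)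
  have "(\<forall>g\<in>set G. (\<Sum>j\<in>J. \<alpha> j * g j) = 0) \<longleftrightarrow> (\<forall>g\<in>set H. (\<Sum>j\<in>J. \<alpha> j * g j) = 0)" for J \<alpha>
    using orthogonal_span[of "set G" \<alpha> J] orthogonal_span[of "set H" \<alpha> J] assms
      span_superset[of "set G"] span_superset[of "set H"] by blast
  then show ?thesis
    by (simp add: matrix_system_def modular_independent_def column_relation_iff)
qed

lemma code_system_eq:
  assumes "generator_matrix C G"
  shows "code_system E C = matrix_system E G"
proof -
  have span: "module.span vscale (set H) = C" if "generator_matrix C H" for H
    using that by (simp add: generator_matrix_def minimal_generating_set_def)
  have "generator_matrix C (SOME G. generator_matrix C G)"
    using assms by (rule someI)
  from span[OF this] span[OF assms] show ?thesis
    unfolding code_system_def by (intro matrix_system_cong) (rule trans[OF _ sym])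
qed

lemma generator_matrix_exists:
  fixes C :: "('e \<Rightarrow> 'r::{comm_ring_1,finite}) set"
  assumes "finite E" "is_code E C"
  shows "\<exists>G. generator_matrix C G"
proof -
  interpret module "vscale :: 'r \<Rightarrow> ('e \<Rightarrow> 'r) \<Rightarrow> 'e \<Rightarrow> 'r"
    by (rule module_vscale)
  have "finite (vecs E :: ('e \<Rightarrow> 'r) set)"
    using finite_set_of_finite_funs[OF assms(1), of "UNIV :: 'r set" 0]
    by (simp add: vecs_def)
  then have "finite C" using assms(2) finite_subset unfolding is_code_def by blast
  moreover have "C \<in> {S. span S = C}"
    using assms(2) unfolding is_code_def by (simp add: span_eq_iff)
  ultimately obtain S where S: "S \<in> minimal_members {S. span S = C}" "S \<subseteq> C"
    using minimal_member_below[of C "{S. span S = C}"] by metis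
  then have "finite S" using \<open>finite C\<close> finite_subset by blast
  then obtain G where "distinct G" "set G = S"
    using finite_distinct_list by blast
  then show ?thesis
    using S(1) by (intro exI[of _ G])
      (auto simp: generator_matrix_def minimal_generating_set_def minimal_members_def)
qed

lemma independence_system_matrix_system:
  assumes "finite E"
  shows "independence_system (matrix_system E G)"
proof -
  have "modular_independent vscale J (column G)"
    if I: "I \<subseteq> E" "modular_independent vscale I (column G)" and J: "J \<subseteq> I" for I J
    unfolding modular_independent_def
  proof (intro allI impI ballI)
    fix \<alpha> j
    assume rel: "(\<Sum>j\<in>J. vscale (\<alpha> j) (column G j)) = 0" and j: "j \<in> J"
    define \<beta> where "\<beta> = (\<lambda>j. if j \<in> J then \<alpha> j else 0)"
    have "(\<Sum>j\<in>I. vscale (\<beta> j) (column G j)) = (\<Sum>j\<in>J. vscale (\<alpha> j) (column G j))"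
      using J finite_subset[OF I(1) assms]
      by (intro sum.mono_neutral_cong_right) (auto simp: \<beta>_def vscale_def fun_eq_iff)
    then have "\<beta> j \<in> max_ideal"
      using rel I(2) j J unfolding modular_independent_def by auto
    then show "\<alpha> j \<in> max_ideal" using j by (simp add: \<beta>_def)
  qed
  moreover have "modular_independent vscale {} (column G)"
    by (simp add: modular_independent_def)
  ultimately show ?thesis
    using assms unfolding independence_system_def matrix_system_def
    by (simp add: Pow_def Collect_mono) (meson subset_trans)
qed

text \<open>The contraction by \<open>{e}\<close> of the system of a code is defined whenever \<open>C\<close> does not
  vanish at \<open>e\<close>.\<close>

lemma singleton_indep_code_system:
  fixes C :: "('e \<Rightarrow> 'r::{comm_ring_1,finite}) set"
  assumes ring: "chain_ring TYPE('r)" "maximal_ideal (I :: 'r set)"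
    and code: "finite E" "is_code E C" and "e \<in> E" "c \<in> C" "pr e c \<noteq> 0"
  shows "{e} \<in> indep (code_system E C)"
proof -
  interpret module "(*) :: 'r \<Rightarrow> 'r \<Rightarrow> 'r" by (rule module_mult)
  obtain G where G: "generator_matrix C G"
    using generator_matrix_exists[OF code] by blast
  then have span_G: "module.span vscale (set G) = C"
    by (simp add: generator_matrix_def minimal_generating_set_def)
  have "\<alpha> e \<in> max_ideal" if rel: "(\<Sum>j\<in>{e}. vscale (\<alpha> j) (column G j)) = 0" for \<alpha>
  proof (rule ccontr)
    assume "\<alpha> e \<notin> max_ideal"
    then have notin: "\<alpha> e \<notin> I" using max_ideal_eq[OF ring] by simp
    have "\<alpha> e \<in> span {\<alpha> e}" by (simp add: span_base)
    moreover have "I \<subseteq> span {\<alpha> e} \<or> span {\<alpha> e} \<subseteq> I"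
      using ring subspace_span[of "{\<alpha> e}"] by (simp add: chain_ring_def maximal_ideal_def)
    moreover have "span {\<alpha> e} = I \<or> span {\<alpha> e} = UNIV" if "I \<subseteq> span {\<alpha> e}"
      using that ring(2) subspace_span[of "{\<alpha> e}"] by (simp add: maximal_ideal_def)
    ultimately have "span {\<alpha> e} = UNIV"
      using notin by blast
    then have "1 \<in> span {\<alpha> e}" by simp
    then obtain k where k: "k * \<alpha> e = 1"
      unfolding span_singleton by (elim rangeE) (rule that, rule sym)
    have "\<forall>g\<in>set G. (\<Sum>j\<in>{e}. \<alpha> j * g j) = 0"
      by (rule iffD1[OF column_relation_iff rel])
    then have "(\<Sum>j\<in>{e}. \<alpha> j * c j) = 0"
      by (rule orthogonal_span) (simp add: span_G \<open>c \<in> C\<close>)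
    then have "\<alpha> e * c e = 0" by simp
    then have "k * \<alpha> e * c e = 0" by (simp only: mult.assoc mult_zero_right)
    then have "c e = 0" by (simp only: k mult_1_left)
    then show False using \<open>pr e c \<noteq> 0\<close> by (simp add: pr_def)
  qed
  then have "modular_independent vscale {e} (column G)"
    unfolding modular_independent_def by blast
  then show ?thesis
    using \<open>e \<in> E\<close> by (simp add: code_system_eq[OF G] matrix_system_def)
qed

end

theory Submission
  imports Defs
begin

text \<open>Call a word a pivot at \<open>e\<close> if its entry at \<open>e\<close> divides all its entries. A multiple of a pivot
  \<open>c\<close> that vanishes at \<open>e\<close> is zero; so if \<open>pr\<^sub>e(C)\<close> is generated by \<open>c\<^sub>e\<close>, then \<open>C\<close> is the direct sum
  of \<open>R c\<close> and the subcode of words vanishing at \<open>e\<close>, which is the shortened code. This gives the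
  block form and identifies the span of \<open>G\<^sub>0'\<close>. Contracting \<open>e\<close> amounts to testing independence of
  \<open>I \<union> {e}\<close>, so it remains to compare relations among columns: a relation on \<open>I\<close> for \<open>G\<^sub>0'\<close>
  extends to \<open>I \<union> {e}\<close> by solving the pivot row for the coefficient at \<open>e\<close>, and conversely the pivot
  row, divided by \<open>c\<^sub>e\<close>, forces that coefficient into the maximal ideal once the others lie there.\<close>

interpretation regular: module "(*) :: 'r::comm_ring_1 \<Rightarrow> 'r \<Rightarrow> 'r"
  by (rule module_mult)

interpretation vec: module "vscale :: 'r::comm_ring_1 \<Rightarrow> ('e \<Rightarrow> 'r) \<Rightarrow> 'e \<Rightarrow> 'r"
  by (rule module_vscale)

section \<open>Units and principal ideals\<close>

lemma mem_principal_ideal_iff: "x \<in> \<langle>a\<rangle> \<longleftrightarrow> a dvd x"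
  by (auto simp: regular.span_singleton dvd_def mult.commute)

lemma principal_ideal_subset_iff: "\<langle>a\<rangle> \<subseteq> \<langle>b\<rangle> \<longleftrightarrow> b dvd a"
  using dvd_trans by (auto simp: subset_iff mem_principal_ideal_iff)

lemma principal_ideal_eq_iff: "\<langle>a\<rangle> = \<langle>b\<rangle> \<longleftrightarrow> a dvd b \<and> b dvd a"
  by (auto simp: set_eq_subset principal_ideal_subset_iff)

lemma unit_mult_dvd:
  assumes "u dvd 1" "a dvd x"
  shows "u * a dvd (x :: 'r::comm_ring_1)"
  using mult_dvd_mono[OF assms] by simp

lemma principal_ideal_unit_mult:
  assumes "u dvd 1"
  shows "\<langle>u * a\<rangle> = \<langle>a\<rangle>"
  using unit_mult_dvd[OF assms dvd_refl, of a] by (simp add: principal_ideal_eq_iff)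

lemma mult_unit_eq_0_iff:
  assumes "u dvd 1"
  shows "a * u = 0 \<longleftrightarrow> a = (0 :: 'r::comm_ring_1)"
  using unit_mult_dvd[OF assms, of a a] by (auto simp: mult.commute)

lemma ideal_eq_UNIV_if_unit:
  assumes I: "is_ideal I" and u: "u \<in> I" "u dvd 1"
  shows "I = UNIV"
proof -
  have "x \<in> \<langle>u\<rangle>" for x
    using unit_mult_dvd[OF u(2), of 1 x] by (simp add: mem_principal_ideal_iff)
  moreover have "\<langle>u\<rangle> \<subseteq> I"
    using I u(1) by (intro regular.span_minimal) auto
  ultimately show ?thesis by blast
qed

lemma chain_ring_dvd_total:
  assumes "chain_ring TYPE('r::comm_ring_1)"
  shows "(x :: 'r) dvd y \<or> y dvd x"
proof -
  have "\<langle>x\<rangle> \<subseteq> \<langle>y\<rangle> \<or> \<langle>y\<rangle> \<subseteq> \<langle>x\<rangle>"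
    using assms by (simp add: chain_ring_def)
  then show ?thesis by (auto simp: principal_ideal_subset_iff)
qed

definition local_ring :: "'r::comm_ring_1 itself \<Rightarrow> bool" where
  "local_ring _ \<longleftrightarrow> is_ideal {x :: 'r. \<not> x dvd 1}"

lemma chain_ring_imp_local_ring:
  assumes "chain_ring TYPE('r::comm_ring_1)"
  shows "local_ring TYPE('r)"
  unfolding local_ring_def
proof (rule regular.subspaceI)
  fix x y :: 'r
  assume "x \<in> {x. \<not> x dvd 1}" "y \<in> {x. \<not> x dvd 1}"
  moreover have "x dvd x + y \<or> y dvd x + y"
    using chain_ring_dvd_total[OF assms, of x y] by auto
  ultimately show "x + y \<in> {x. \<not> x dvd 1}"
    using dvd_trans by blast
qed (auto dest: dvd_mult_right)

lemma max_ideal_local_ring: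
  assumes "local_ring TYPE('r::comm_ring_1)"
  shows "max_ideal = {x :: 'r. \<not> x dvd 1}"
  unfolding max_ideal_def
proof (rule the_equality)
  have ideal: "is_ideal {x :: 'r. \<not> x dvd 1}"
    using assms by (simp add: local_ring_def)
  have "1 \<notin> {x :: 'r. \<not> x dvd 1}" by simp
  then have proper: "{x :: 'r. \<not> x dvd 1} \<noteq> UNIV" by blast
  have "J = {x. \<not> x dvd 1} \<or> J = UNIV" if "is_ideal J" "{x. \<not> x dvd 1} \<subseteq> J" for J :: "'r set"
    using that(2) ideal_eq_UNIV_if_unit[OF that(1)] by blast
  with ideal proper show "maximal_ideal {x :: 'r. \<not> x dvd 1}"
    by (simp add: maximal_ideal_def)
  fix I :: "'r set"
  assume I: "maximal_ideal I"
  then have "I \<subseteq> {x. \<not> x dvd 1}"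
    using ideal_eq_UNIV_if_unit[of I] by (auto simp: maximal_ideal_def)
  with I ideal proper show "I = {x. \<not> x dvd 1}"
    unfolding maximal_ideal_def by metis
qed

lemma is_ideal_max_ideal:
  assumes "local_ring TYPE('r::comm_ring_1)"
  shows "is_ideal (max_ideal :: 'r set)"
  using assms unfolding max_ideal_local_ring[OF assms] by (simp add: local_ring_def)

lemma annihilator_mem_max_ideal:
  assumes "local_ring TYPE('r::comm_ring_1)" "a * x = 0" "a \<noteq> (0 :: 'r)"
  shows "x \<in> max_ideal"
  using assms mult_unit_eq_0_iff by (auto simp: max_ideal_local_ring)

lemma local_ring_unit_or_unit_diff:
  assumes "local_ring TYPE('r::comm_ring_1)"
  shows "(x :: 'r) dvd 1 \<or> 1 - x dvd 1"
  using assms regular.subspace_add[of "{x :: 'r. \<not> x dvd 1}" x "1 - x"]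
  by (auto simp: local_ring_def)

lemma local_ring_principal_ideal_eq_iff:
  assumes "local_ring TYPE('r::comm_ring_1)"
  shows "\<langle>a\<rangle> = \<langle>b :: 'r\<rangle> \<longleftrightarrow> (\<exists>u. u dvd 1 \<and> a = u * b)"
proof
  assume "\<langle>a\<rangle> = \<langle>b\<rangle>"
  then obtain r s where s: "a = b * s" and r: "b = a * r"
    by (auto simp: principal_ideal_eq_iff dvd_def)
  have "b * (s * r) = b"
    by (simp only: mult.assoc[symmetric] s[symmetric] r[symmetric])
  then have ann: "b * (1 - s * r) = 0"
    by (simp add: right_diff_distrib)
  from local_ring_unit_or_unit_diff[OF assms] show "\<exists>u. u dvd 1 \<and> a = u * b"
  proof
    assume "s * r dvd 1"
    then have "s dvd 1" by (rule dvd_mult_left)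
    then show ?thesis using s by (auto simp: mult.commute)
  next
    assume "1 - s * r dvd 1"
    then have "b = 0" using ann by (simp add: mult_unit_eq_0_iff)
    then show ?thesis using s by (intro exI[of _ 1]) simp
  qed
qed (auto simp: principal_ideal_unit_mult)

lemma power_neq_0_below_nilpotency_index:
  assumes "n < nilpotency_index a"
  shows "a ^ n \<noteq> 0"
  using assms not_less_Least unfolding nilpotency_index_def by blast

section \<open>Contractions\<close>

lemma system_of_circuits_minimal_members:
  assumes "finite E"
  shows "system_of_circuits E (minimal_members F) = system_of_circuits E F"
proof -
  have "I \<subseteq> E \<and> (\<forall>D\<in>minimal_members F. \<not> D \<subseteq> I) \<longleftrightarrow> I \<subseteq> E \<and> (\<forall>D\<in>F. \<not> D \<subseteq> I)"
    for I
  proof (intro conj_cong refl iffI ballI notI)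
    fix D assume I: "I \<subseteq> E" "\<forall>D\<in>minimal_members F. \<not> D \<subseteq> I" and D: "D \<in> F" "D \<subseteq> I"
    then have "finite D" using assms by (meson finite_subset)
    then obtain D' where "D' \<in> minimal_members F" "D' \<subseteq> D"
      using minimal_member_below D(1) by blast
    then show False using I(2) D(2) by blast
  qed (use minimal_members_subset in blast)
  then show ?thesis by (simp add: system_of_circuits_def)
qed

lemma contraction_eq:
  assumes M: "independence_system M" and T: "T \<subseteq> ground M"
  shows "contraction M T =
    \<lparr>ground = ground M - T, indep = {I. I \<subseteq> ground M - T \<and> I \<union> T \<in> indep M}\<rparr>"
proof -
  have "finite (ground M - T)"
    using M by (simp add: independence_system_def)
  then have "contraction M T = system_of_circuits (ground M - T) {D - T |D. D \<in> circuits M}"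
    unfolding contraction_def by (rule system_of_circuits_minimal_members)
  moreover have "I \<subseteq> ground M - T \<and> (\<forall>D\<in>{D - T |D. D \<in> circuits M}. \<not> D \<subseteq> I) \<longleftrightarrow>
      I \<subseteq> ground M - T \<and> I \<union> T \<in> indep M" for I
  proof (rule conj_cong[OF refl])
    assume "I \<subseteq> ground M - T"
    have "(\<forall>D\<in>{D - T |D. D \<in> circuits M}. \<not> D \<subseteq> I) \<longleftrightarrow> (\<forall>D\<in>circuits M. \<not> D \<subseteq> I \<union> T)"
      by (auto simp: Diff_subset_conv Un_commute)
    also have "\<dots> \<longleftrightarrow> I \<union> T \<in> indep (system_of_circuits (ground M) (circuits M))"
      using \<open>I \<subseteq> ground M - T\<close> T by (auto simp: system_of_circuits_def)
    finally show "(\<forall>D\<in>{D - T |D. D \<in> circuits M}. \<not> D \<subseteq> I) \<longleftrightarrow> I \<union> T \<in> indep M"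
      by (simp only: system_of_circuits_circuits[OF M])
  qed
  ultimately show ?thesis
    by (simp only: system_of_circuits_def)
qed

section \<open>Pivots\<close>

definition pivot :: "'e \<Rightarrow> ('e \<Rightarrow> 'r::comm_ring_1) \<Rightarrow> bool" where
  "pivot e c \<longleftrightarrow> (\<forall>i. c e dvd c i)"

lemma pivotE:
  assumes "pivot e c"
  obtains b where "b e = 1" "c = vscale (c e) b"
proof -
  obtain b where b: "\<And>i. c i = c e * b i"
    using assms unfolding pivot_def dvd_def by metis
  have "c i = vscale (c e) (b(e := 1)) i" for i
  proof (cases "i = e")
    case False
    then show ?thesis using b[of i] by (simp add: vscale_def)
  qed (simp add: vscale_def)
  then have "c = vscale (c e) (b(e := 1))" by (rule ext)
  then show thesis by (rule that[rotated]) simp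
qed

definition vanishing_at :: "'e \<Rightarrow> ('e \<Rightarrow> 'r::comm_ring_1) set" where
  "vanishing_at e = {x. x e = 0}"

lemma subspace_vanishing_at: "vec.subspace (vanishing_at e)"
  by (simp add: vanishing_at_def vec.subspace_def vscale_def)

lemma vecs_Diff_singleton: "vecs (E - {e}) = vecs E \<inter> vanishing_at e"
  by (auto simp: vecs_def vanishing_at_def)

lemma pivot_multiple_vanishing_at:
  assumes "pivot e c" "vscale k c \<in> vanishing_at e"
  shows "vscale k c = 0"
proof -
  obtain b where c: "c = vscale (c e) b"
    using assms(1) by (rule pivotE)
  have "k * c e = 0"
    using assms(2) by (simp add: vanishing_at_def vscale_def)
  moreover have "vscale k c = vscale (k * c e) b"
    by (subst c) simp
  ultimately show ?thesis by simp
qed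

lemma span_insert_pivot_Int_vanishing_at:
  assumes c: "pivot e c" and S: "S \<subseteq> vanishing_at e"
  shows "vec.span (insert c S) \<inter> vanishing_at e = vec.span S"
proof
  have span_S: "vec.span S \<subseteq> vanishing_at e"
    by (rule vec.span_minimal[OF S subspace_vanishing_at])
  then show "vec.span S \<subseteq> vec.span (insert c S) \<inter> vanishing_at e"
    using vec.span_mono[of S "insert c S"] by blast
  show "vec.span (insert c S) \<inter> vanishing_at e \<subseteq> vec.span S"
  proof
    fix x assume x: "x \<in> vec.span (insert c S) \<inter> vanishing_at e"
    then obtain k where k: "x - vscale k c \<in> vec.span S"
      by (auto simp: vec.span_breakdown_eq)
    then have "x - vscale k c \<in> vanishing_at e"
      using span_S by blast
    then have "vscale k c \<in> vanishing_at e"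
      using x by (simp add: vanishing_at_def)
    then have "vscale k c = 0"
      by (rule pivot_multiple_vanishing_at[OF c])
    then show "x \<in> vec.span S" using k by simp
  qed
qed

lemma span_insert_pivot:
  assumes C: "vec.subspace C" and c: "c \<in> C" "pr e ` C = \<langle>c e\<rangle>"
    and S: "vec.span S = C \<inter> vanishing_at e"
  shows "vec.span (insert c S) = C"
proof
  show "vec.span (insert c S) \<subseteq> C"
    using c(1) S vec.span_superset[of S] by (intro vec.span_minimal[OF _ C]) auto
  show "C \<subseteq> vec.span (insert c S)"
  proof
    fix x assume x: "x \<in> C"
    then have "c e dvd x e"
      using c(2) by (auto simp: pr_def simp flip: mem_principal_ideal_iff)
    then obtain k where "x e = c e * k" by (rule dvdE)
    then have "x - vscale k c \<in> vanishing_at e"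
      by (simp add: vanishing_at_def vscale_def mult.commute)
    moreover have "x - vscale k c \<in> C"
      using C x c(1) by (intro vec.subspace_diff vec.subspace_scale)
    ultimately show "x \<in> vec.span (insert c S)"
      using S by (auto simp: vec.span_breakdown_eq)
  qed
qed

lemma minimal_generating_set_insert_pivot:
  assumes C: "vec.subspace C" and c: "c \<in> C" "pr e ` C = \<langle>c e\<rangle>" "pivot e c" "c e \<noteq> 0"
    and S: "minimal_generating_set (C \<inter> vanishing_at e) S"
  shows "minimal_generating_set C (insert c S)"
  unfolding minimal_generating_set_def
proof (intro conjI allI impI notI)
  have span: "vec.span S = C \<inter> vanishing_at e"
    using S by (simp add: minimal_generating_set_def)
  then show "vec.span (insert c S) = C"
    by (rule span_insert_pivot[OF C c(1,2)])
  have S_van: "S \<subseteq> vanishing_at e"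
    using span vec.span_superset[of S] by blast
  fix S' assume S': "S' \<subset> insert c S" and span': "vec.span S' = C"
  show False
  proof (cases "c \<in> S'")
    case True
    then have proper: "S' - {c} \<subset> S" and ins: "insert c (S' - {c}) = S'"
      using S' by auto
    then have "vec.span (S' - {c}) = C \<inter> vanishing_at e"
      using span_insert_pivot_Int_vanishing_at[OF c(3), of "S' - {c}"] S_van span' by auto
    then show False
      using S proper by (simp add: minimal_generating_set_def)
  next
    case False
    then have "S' \<subseteq> vanishing_at e" using S' S_van by blast
    then have "C \<subseteq> vanishing_at e"
      using vec.span_minimal[OF _ subspace_vanishing_at] span' by metis
    then show False using c(1,4) by (auto simp: vanishing_at_def)
  qed
qed

section \<open>Generator matrices\<close>

lemma span_generator_matrix:
  assumes "generator_matrix C G"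
  shows "vec.span (set G) = C"
  using assms by (simp add: generator_matrix_def minimal_generating_set_def)

lemma is_code_Int_vanishing_at:
  assumes "is_code E C"
  shows "is_code (E - {e}) (C \<inter> vanishing_at e)"
  using assms vec.subspace_inter[OF _ subspace_vanishing_at]
  by (auto simp: is_code_def vecs_Diff_singleton)

lemma shortened_singleton:
  assumes "C \<subseteq> vecs E"
  shows "shortened E C {e} = C \<inter> vanishing_at e"
proof -
  have "vrestrict (E - {e}) x = x" if "x \<in> C \<inter> vanishing_at e" for x
    using that assms by (auto simp: vrestrict_def vecs_def vanishing_at_def fun_eq_iff)
  then show ?thesis by (auto simp: shortened_def vanishing_at_def)
qed

lemma code_system_eq_matrix_system:
  fixes C :: "('e \<Rightarrow> 'r::{comm_ring_1,finite}) set"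
  assumes "finite E" "is_code E C" "vec.span (set G) = C"
  shows "code_system E C = matrix_system E G"
proof -
  obtain H where H: "generator_matrix C H"
    using generator_matrix_exists[OF assms(1,2)] by blast
  then have "code_system E C = matrix_system E H"
    by (rule code_system_eq)
  also have "\<dots> = matrix_system E G"
    by (rule matrix_system_cong) (simp add: span_generator_matrix[OF H] assms(3))
  finally show ?thesis .
qed

lemma code_system_shortened_pivot:
  fixes C :: "('e \<Rightarrow> 'r::{comm_ring_1,finite}) set"
  assumes "finite E" "is_code E C" "generator_matrix C (c # H)"
    and "pivot e c" "set H \<subseteq> vanishing_at e"
  shows "code_system (E - {e}) (shortened E C {e}) = matrix_system (E - {e}) H"
proof -
  have "vec.span (set H) = C \<inter> vanishing_at e"
    using span_insert_pivot_Int_vanishing_at[OF assms(4,5)] span_generator_matrix[OF assms(3)]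
    by simp
  then have "code_system (E - {e}) (C \<inter> vanishing_at e) = matrix_system (E - {e}) H"
    using assms(1,2) by (intro code_system_eq_matrix_system is_code_Int_vanishing_at) auto
  then show ?thesis
    using assms(2) by (simp add: shortened_singleton is_code_def)
qed

lemma contractible_imp_pivot:
  assumes "contractible \<theta> E C e" "C \<subseteq> vecs E"
  obtains c where "c \<in> C" "pivot e c" "c e \<noteq> 0" "pr e ` C = \<langle>c e\<rangle>"
proof -
  obtain s c u where C: "pr e ` C \<noteq> {0}" "pr e ` C = \<langle>\<theta> ^ s\<rangle>" and c: "c \<in> C"
    and u: "u dvd 1" "c e = u * \<theta> ^ s" and entries: "\<forall>i\<in>E. c i \<in> \<langle>\<theta> ^ s\<rangle>"
    using assms(1) unfolding contractible_def by blast
  have ideal: "pr e ` C = \<langle>c e\<rangle>"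
    using C(2) u by (simp add: principal_ideal_unit_mult)
  have "c e dvd c i" for i
  proof (cases "i \<in> E")
    case True
    then show ?thesis
      using entries ideal C(2) by (metis mem_principal_ideal_iff)
  next
    case False
    then show ?thesis using c assms(2) by (auto simp: vecs_def)
  qed
  then have "pivot e c" by (simp add: pivot_def)
  moreover have "c e \<noteq> 0" using ideal C(1) by (auto simp: mem_principal_ideal_iff)
  ultimately show thesis using that c ideal by blast
qed

lemma contractible_pivot_generator_matrix:
  fixes C :: "('e \<Rightarrow> 'r::{comm_ring_1,finite}) set"
  assumes "finite E" "is_code E C" "contractible \<theta> E C e"
  obtains c H where "generator_matrix C (c # H)" "pivot e c" "pr e ` C = \<langle>c e\<rangle>"
    "c \<in> vecs E" "set H \<subseteq> vecs (E - {e})"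
proof -
  have C: "C \<subseteq> vecs E" "vec.subspace C" using assms(2) by (auto simp: is_code_def)
  obtain c where c: "c \<in> C" "pivot e c" "c e \<noteq> 0" "pr e ` C = \<langle>c e\<rangle>"
    using contractible_imp_pivot[OF assms(3) C(1)] .
  obtain H where H: "generator_matrix (C \<inter> vanishing_at e) H"
    using generator_matrix_exists[OF _ is_code_Int_vanishing_at[OF assms(2)]] assms(1) by blast
  have rows: "set H \<subseteq> C \<inter> vanishing_at e"
    using span_generator_matrix[OF H] vec.span_superset[of "set H"] by simp
  have "minimal_generating_set C (set (c # H))"
    using minimal_generating_set_insert_pivot[OF C(2) c(1,4,2,3)] H
    by (simp add: generator_matrix_def)
  moreover have "distinct (c # H)"
    using H rows c(3) by (auto simp: generator_matrix_def vanishing_at_def)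
  ultimately have "generator_matrix C (c # H)"
    by (simp add: generator_matrix_def)
  moreover have "set H \<subseteq> vecs (E - {e})"
    using rows C(1) by (auto simp: vecs_Diff_singleton)
  ultimately show thesis using that c C(1) by blast
qed

lemma block_matrix_eq_Cons:
  assumes "set H \<subseteq> vecs (E - {e})"
  shows "block_matrix e p a H = a(e := p) # H"
proof -
  have "map (\<lambda>g. g(e := 0)) H = map id H"
    using assms by (intro map_cong) (auto simp: vecs_def fun_eq_iff)
  then show ?thesis by (simp add: block_matrix_def)
qed

text \<open>The exponent hidden in \<open>contractible\<close> need not be \<open>t\<close>; only the ideals agree. Describing
  pivot forms by the ideal of the pivot entry makes the exponents irrelevant.\<close>

lemma pivot_form_iff:
  fixes \<theta> :: "'r::comm_ring_1"
  assumes "local_ring TYPE('r)" "e \<in> E"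
  shows "pivot_form \<theta> t E e G H \<longleftrightarrow> set H \<subseteq> vecs (E - {e}) \<and>
    (\<exists>c\<in>vecs E. pivot e c \<and> \<langle>c e\<rangle> = \<langle>\<theta> ^ t\<rangle> \<and> G = c # H)"
proof
  assume "pivot_form \<theta> t E e G H"
  then obtain u a where H: "set H \<subseteq> vecs (E - {e})" and u: "u dvd 1"
    and a: "a \<in> vecs (E - {e})" "\<forall>i\<in>E - {e}. a i \<in> \<langle>\<theta> ^ t\<rangle>"
    and G: "G = block_matrix e (u * \<theta> ^ t) a H"
    unfolding pivot_form_def by blast
  let ?c = "a(e := u * \<theta> ^ t)"
  have "a i \<in> \<langle>\<theta> ^ t\<rangle>" for i
    using a by (cases "i \<in> E - {e}") (auto simp: vecs_def mem_principal_ideal_iff)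
  then have "pivot e ?c"
    by (simp add: pivot_def mem_principal_ideal_iff unit_mult_dvd[OF u])
  moreover have "?c \<in> vecs E" using a(1) assms(2) by (auto simp: vecs_def)
  ultimately show "set H \<subseteq> vecs (E - {e}) \<and>
      (\<exists>c\<in>vecs E. pivot e c \<and> \<langle>c e\<rangle> = \<langle>\<theta> ^ t\<rangle> \<and> G = c # H)"
    using H u by (auto simp: G block_matrix_eq_Cons principal_ideal_unit_mult)
next
  assume "set H \<subseteq> vecs (E - {e}) \<and>
    (\<exists>c\<in>vecs E. pivot e c \<and> \<langle>c e\<rangle> = \<langle>\<theta> ^ t\<rangle> \<and> G = c # H)"
  then obtain c where H: "set H \<subseteq> vecs (E - {e})" and c: "c \<in> vecs E" "pivot e c"
    and ideal: "\<langle>c e\<rangle> = \<langle>\<theta> ^ t\<rangle>" and G: "G = c # H" by blast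
  obtain u where u: "u dvd 1" "c e = u * \<theta> ^ t"
    using ideal local_ring_principal_ideal_eq_iff[OF assms(1)] by blast
  have "c i \<in> \<langle>\<theta> ^ t\<rangle>" for i
    using c(2) by (simp add: pivot_def mem_principal_ideal_iff flip: ideal)
  moreover have "c(e := 0) \<in> vecs (E - {e})" using c(1) by (auto simp: vecs_def)
  moreover have "G = block_matrix e (u * \<theta> ^ t) (c(e := 0)) H"
    by (simp add: G block_matrix_eq_Cons[OF H] flip: u(2))
  ultimately show "pivot_form \<theta> t E e G H"
    unfolding pivot_form_def using H u(1)
    by (intro conjI exI[of _ u] exI[of _ "c(e := 0)"]) auto
qed

section \<open>Relations among columns\<close>

definition column_relations ::
  "('e, 'r::comm_ring_1) rowmat \<Rightarrow> 'e set \<Rightarrow> ('e \<Rightarrow> 'r) set" where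
  "column_relations G J = {\<alpha>. \<forall>g\<in>set G. (\<Sum>j\<in>J. \<alpha> j * g j) = 0}"

lemma modular_independent_column_iff:
  "modular_independent vscale J (column G) \<longleftrightarrow>
    (\<forall>\<alpha>\<in>column_relations G J. \<forall>j\<in>J. \<alpha> j \<in> max_ideal)"
  by (auto simp: modular_independent_def column_relation_iff column_relations_def)

lemma column_relations_Cons_insert:
  assumes I: "finite I" "e \<notin> I" and H: "set H \<subseteq> vanishing_at e"
    and c: "c = vscale (c e) b" "b e = 1"
  shows "\<alpha> \<in> column_relations (c # H) (insert e I) \<longleftrightarrow>
    c e * (\<alpha> e + (\<Sum>j\<in>I. \<alpha> j * b j)) = 0 \<and> \<alpha> \<in> column_relations H I"
proof -
  have "c j = c e * b j" for j
    using fun_cong[OF c(1)] unfolding vscale_def .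
  then have "(\<Sum>j\<in>insert e I. \<alpha> j * c j) = c e * (\<Sum>j\<in>insert e I. \<alpha> j * b j)"
    unfolding sum_distrib_left by (metis mult.left_commute)
  then have row: "(\<Sum>j\<in>insert e I. \<alpha> j * c j) = c e * (\<alpha> e + (\<Sum>j\<in>I. \<alpha> j * b j))"
    using I c(2) by simp
  have "(\<Sum>j\<in>insert e I. \<alpha> j * g j) = (\<Sum>j\<in>I. \<alpha> j * g j)" if "g \<in> set H" for g
    using that I H by (auto simp: vanishing_at_def)
  then show ?thesis by (simp add: column_relations_def row del: sum.insert)
qed

lemma column_relation_extends_to_pivot:
  assumes I: "finite I" "e \<notin> I" and H: "set H \<subseteq> vanishing_at e" and c: "pivot e c"
    and \<alpha>: "\<alpha> \<in> column_relations H I"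
  obtains x where "\<alpha>(e := x) \<in> column_relations (c # H) (insert e I)"
proof -
  obtain b where b: "b e = 1" "c = vscale (c e) b"
    using c by (rule pivotE)
  define x where "x = - (\<Sum>j\<in>I. \<alpha> j * b j)"
  have agree: "(\<Sum>j\<in>I. (\<alpha>(e := x)) j * g j) = (\<Sum>j\<in>I. \<alpha> j * g j)" for g
    using I(2) by (intro sum.cong) auto
  have "\<alpha>(e := x) \<in> column_relations (c # H) (insert e I)"
    unfolding column_relations_Cons_insert[OF I H b(2,1)] agree
    using \<alpha> agree by (simp add: x_def column_relations_def)
  then show thesis by (rule that)
qed

lemma column_relation_pivot_coefficient_mem_max_ideal:
  fixes c :: "'e \<Rightarrow> 'r::comm_ring_1"
  assumes ring: "local_ring TYPE('r)" and I: "finite I" "e \<notin> I"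
    and H: "set H \<subseteq> vanishing_at e" and c: "pivot e c" "c e \<noteq> 0"
    and \<alpha>: "\<alpha> \<in> column_relations (c # H) (insert e I)" "\<And>j. j \<in> I \<Longrightarrow> \<alpha> j \<in> max_ideal"
  shows "\<alpha> e \<in> max_ideal"
proof -
  note ideal = is_ideal_max_ideal[OF ring]
  obtain b where b: "b e = 1" "c = vscale (c e) b"
    using c(1) by (rule pivotE)
  have "c e * (\<alpha> e + (\<Sum>j\<in>I. \<alpha> j * b j)) = 0"
    using \<alpha>(1) column_relations_Cons_insert[OF I H b(2,1)] by blast
  then have "\<alpha> e + (\<Sum>j\<in>I. \<alpha> j * b j) \<in> max_ideal"
    using annihilator_mem_max_ideal[OF ring _ c(2)] by blast
  moreover have "(\<Sum>j\<in>I. \<alpha> j * b j) \<in> max_ideal"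
    using regular.subspace_scale[OF ideal \<alpha>(2)]
    by (intro regular.subspace_sum[OF ideal]) (metis mult.commute)
  ultimately have "\<alpha> e + (\<Sum>j\<in>I. \<alpha> j * b j) - (\<Sum>j\<in>I. \<alpha> j * b j) \<in> max_ideal"
    by (rule regular.subspace_diff[OF ideal])
  then show ?thesis by (simp only: add_diff_cancel_right')
qed

lemma modular_independent_insert_pivot:
  fixes c :: "'e \<Rightarrow> 'r::comm_ring_1"
  assumes ring: "local_ring TYPE('r)" and I: "finite I" "e \<notin> I"
    and H: "set H \<subseteq> vanishing_at e" and c: "pivot e c" "c e \<noteq> 0"
  shows "modular_independent vscale (insert e I) (column (c # H)) \<longleftrightarrow>
    modular_independent vscale I (column H)"
  unfolding modular_independent_column_iff
proof (intro iffI ballI)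
  fix \<alpha> j
  assume indep: "\<forall>\<alpha>\<in>column_relations (c # H) (insert e I). \<forall>j\<in>insert e I. \<alpha> j \<in> max_ideal"
    and \<alpha>: "\<alpha> \<in> column_relations H I" and j: "j \<in> I"
  obtain x where "\<alpha>(e := x) \<in> column_relations (c # H) (insert e I)"
    using column_relation_extends_to_pivot[OF I H c(1) \<alpha>] .
  with indep j have "(\<alpha>(e := x)) j \<in> max_ideal" by blast
  then show "\<alpha> j \<in> max_ideal" using I(2) j by (auto split: if_splits)
next
  fix \<alpha> j
  assume indep: "\<forall>\<alpha>\<in>column_relations H I. \<forall>j\<in>I. \<alpha> j \<in> max_ideal"
    and \<alpha>: "\<alpha> \<in> column_relations (c # H) (insert e I)" and j: "j \<in> insert e I"
  obtain b where "b e = 1" "c = vscale (c e) b"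
    using c(1) by (rule pivotE)
  then have "\<alpha> \<in> column_relations H I"
    using \<alpha> column_relations_Cons_insert[OF I H] by blast
  with indep have "\<alpha> i \<in> max_ideal" if "i \<in> I" for i
    using that by blast
  then show "\<alpha> j \<in> max_ideal"
    using column_relation_pivot_coefficient_mem_max_ideal[OF ring I H c \<alpha>] j by blast
qed

lemma contraction_matrix_system_pivot:
  fixes c :: "'e \<Rightarrow> 'r::comm_ring_1"
  assumes ring: "local_ring TYPE('r)" and E: "finite E" "e \<in> E"
    and H: "set H \<subseteq> vanishing_at e" and c: "pivot e c" "c e \<noteq> 0"
  shows "contraction (matrix_system E (c # H)) {e} = matrix_system (E - {e}) H"
proof -
  have "I \<subseteq> E - {e} \<and> insert e I \<in> indep (matrix_system E (c # H)) \<longleftrightarrow>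
      I \<subseteq> E - {e} \<and> modular_independent vscale I (column H)" for I
  proof (rule conj_cong[OF refl])
    assume I: "I \<subseteq> E - {e}"
    then have "finite I" "e \<notin> I" using E(1) finite_subset by auto
    from modular_independent_insert_pivot[OF ring this H c] I E(2)
    show "insert e I \<in> indep (matrix_system E (c # H)) \<longleftrightarrow>
        modular_independent vscale I (column H)"
      by (auto simp: matrix_system_def)
  qed
  moreover have "ground (matrix_system E (c # H)) = E"
    by (simp add: matrix_system_def)
  ultimately show ?thesis
    using E(2) contraction_eq[OF independence_system_matrix_system[OF E(1)], of "{e}" "c # H"]
    by (simp add: matrix_system_def[of "E - {e}"])
qed

theorem theorem4p12:
  fixes \<theta> :: "'r::{comm_ring_1,finite}" and \<nu> t :: nat
    and E :: "'e set" and C :: "('e \<Rightarrow> 'r) set" and e :: 'e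
  assumes "chain_ring TYPE('r)"
    and "maximal_ideal \<langle>\<theta>\<rangle>"
    and "\<nu> = nilpotency_index \<theta>"
    and "finite E"
    and "is_code E C"
    and "e \<in> E"
    and "contractible \<theta> E C e"
    and "pr e ` C = \<langle>\<theta> ^ t\<rangle>"
    and "t < \<nu>"
  shows "(\<exists>G\<^sub>0 G\<^sub>0'. generator_matrix C G\<^sub>0 \<and> pivot_form \<theta> t E e G\<^sub>0 G\<^sub>0') \<and>
    (\<forall>G\<^sub>0 G\<^sub>0'. generator_matrix C G\<^sub>0 \<and> pivot_form \<theta> t E e G\<^sub>0 G\<^sub>0' \<longrightarrow>
       code_system (E - {e}) (shortened E C {e}) = matrix_system (E - {e}) G\<^sub>0' \<and>
       matrix_system (E - {e}) G\<^sub>0' = contraction (code_system E C) {e})"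
proof (intro conjI[OF _ allI[OF allI[OF impI]]])
  have ring: "local_ring TYPE('r)"
    by (rule chain_ring_imp_local_ring[OF assms(1)])
  note form_iff = pivot_form_iff[OF ring assms(6)]
  obtain c H where "generator_matrix C (c # H)" "pivot e c" "pr e ` C = \<langle>c e\<rangle>"
    "c \<in> vecs E" "set H \<subseteq> vecs (E - {e})"
    using contractible_pivot_generator_matrix[OF assms(4,5,7)] .
  then show "\<exists>G\<^sub>0 G\<^sub>0'. generator_matrix C G\<^sub>0 \<and> pivot_form \<theta> t E e G\<^sub>0 G\<^sub>0'"
    using assms(8) by (auto simp: form_iff)
  fix G H assume "generator_matrix C G \<and> pivot_form \<theta> t E e G H"
  then obtain c where H: "set H \<subseteq> vanishing_at e" and c: "pivot e c" "\<langle>c e\<rangle> = \<langle>\<theta> ^ t\<rangle>"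
    and gen: "generator_matrix C (c # H)"
    unfolding form_iff vecs_Diff_singleton by blast
  have "c e \<noteq> 0"
    using c(2) power_neq_0_below_nilpotency_index[of t \<theta>] assms(3,9)
    by (auto simp: principal_ideal_eq_iff)
  then show "code_system (E - {e}) (shortened E C {e}) = matrix_system (E - {e}) H \<and>
      matrix_system (E - {e}) H = contraction (code_system E C) {e}"
    using code_system_shortened_pivot[OF assms(4,5) gen c(1) H]
      contraction_matrix_system_pivot[OF ring assms(4,6) H c(1)] code_system_eq[OF gen] by simp
qed

end
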